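(* Let $F$ be a Ferrers shape, let $n\ge 0$ be an integer and let $s,t$ be positive integers. Let $N(F;n;\mathit{NE}=s,\mathit{SE}=t)$ denote the number of $0$-$1$-fillings of $F$ with exactly $n$ entries equal to $1$ such that every row and every column of $F$ contains at most one $1$, the longest NE-chain has length $s$, and the longest SE-chain (among SE-chains whose smallest enclosing rectangle is contained in $F$) has length $t$. Then $$N(F;n;\mathit{NE}=s,\mathit{SE}=t)=N(F;n;\mathit{NE}=t,\mathit{SE}=s).$$
   Context: A Ferrers shape (in French notation) is a finite set of unit cells arranged in columns $1,\dots,m$ from left to right and rows numbered from the bottom, where column $j$ consists of the cells in rows $1,\dots,h_j$ and $h_1\ge h_2\ge\dots\ge h_m\ge 1$ (so it has a straight left side, a straight bottom side, and the columns weakly decrease in height from left to right). A $0$-$1$-filling assigns $0$ or $1$ to every cell. An NE-chain is a sequence of cells containing $1$ such that each cell in the sequence lies strictly above and strictly to the right of the preceding one; an SE-chain is a sequence of cells containing $1$ such that each lies strictly below and strictly to the right of the preceding one. The length of a chain is the number of its cells. The smallest rectangle containing a chain is the set of cells whose column lies between the columns of the first and last cells and whose row lies between the rows of the first and last cells; for SE-chains only those whose smallest rectangle lies entirely in $F$ are considered (for NE-chains this holds automatically). *)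

theory Defs
  imports Main "HOL-Library.FuncSet"
begin

text \<open>A cell is a pair (column, row), both counted from 1; rows are counted from the bottom.\<close>

type_synonym cell = "nat \<times> nat"

definition ferrers_cells :: "nat list \<Rightarrow> cell set" where
  "ferrers_cells hs = {(j, i). 1 \<le> j \<and> j \<le> length hs \<and> 1 \<le> i \<and> i \<le> hs ! (j - 1)}"

definition ferrers_shape :: "cell set \<Rightarrow> bool" where
  "ferrers_shape F \<longleftrightarrow>
     (\<exists>hs. sorted_wrt (\<ge>) hs \<and> (\<forall>h \<in> set hs. 1 \<le> h) \<and> F = ferrers_cells hs)"

definition fillings :: "cell set \<Rightarrow> (cell \<Rightarrow> nat) set" where
  "fillings F = F \<rightarrow>\<^sub>E {0, 1}"

definition ones :: "cell set \<Rightarrow> (cell \<Rightarrow> nat) \<Rightarrow> cell set" where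
  "ones F f = {c \<in> F. f c = 1}"

definition at_most_one_per_line :: "cell set \<Rightarrow> (cell \<Rightarrow> nat) \<Rightarrow> bool" where
  "at_most_one_per_line F f \<longleftrightarrow>
     (\<forall>j. card {c \<in> ones F f. fst c = j} \<le> 1) \<and>
     (\<forall>i. card {c \<in> ones F f. snd c = i} \<le> 1)"

definition NE_chain :: "cell set \<Rightarrow> (cell \<Rightarrow> nat) \<Rightarrow> cell list \<Rightarrow> bool" where
  "NE_chain F f cs \<longleftrightarrow>
     set cs \<subseteq> ones F f \<and> successively (\<lambda>c d. fst c < fst d \<and> snd c < snd d) cs"

definition SE_chain :: "cell set \<Rightarrow> (cell \<Rightarrow> nat) \<Rightarrow> cell list \<Rightarrow> bool" where
  "SE_chain F f cs \<longleftrightarrow>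
     set cs \<subseteq> ones F f \<and> successively (\<lambda>c d. fst c < fst d \<and> snd c > snd d) cs"

text \<open>
  The rectangle spanned by the first and last cell of a chain; the positions in it need not
  belong to the shape.
\<close>

definition enclosing_rectangle :: "cell list \<Rightarrow> cell set" where
  "enclosing_rectangle cs =
     (if cs = [] then {}
      else {(j, i).
        min (fst (hd cs)) (fst (last cs)) \<le> j \<and> j \<le> max (fst (hd cs)) (fst (last cs)) \<and>
        min (snd (hd cs)) (snd (last cs)) \<le> i \<and> i \<le> max (snd (hd cs)) (snd (last cs))})"

text \<open>
  The empty list is a chain, so both maxima range over nonempty sets; they are finite
  whenever the shape is, since the cells of a chain are distinct.
\<close>

definition longest_NE :: "cell set \<Rightarrow> (cell \<Rightarrow> nat) \<Rightarrow> nat" where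
  "longest_NE F f = Max {length cs | cs. NE_chain F f cs}"

definition longest_SE :: "cell set \<Rightarrow> (cell \<Rightarrow> nat) \<Rightarrow> nat" where
  "longest_SE F f = Max {length cs | cs. SE_chain F f cs \<and> enclosing_rectangle cs \<subseteq> F}"

definition num_fillings :: "cell set \<Rightarrow> nat \<Rightarrow> nat \<Rightarrow> nat \<Rightarrow> nat" where
  "num_fillings F n s t =
     card {f \<in> fillings F. card (ones F f) = n \<and> at_most_one_per_line F f \<and>
             longest_NE F f = s \<and> longest_SE F f = t}"

end

theory Submission imports Defs begin

text \<open>
  Krattenthaler's argument: view a filling as a placement of rooks and attach to every lattice point
  \<open>(x, y)\<close> the partition computed from the placement by Fomin's local rules. These rules are
  invertible, so a placement in the shape is the same thing as a sequence of partitions along its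
  north-east boundary in which neighbours differ by at most one box. The first row and the first
  column of the partition at a boundary point are the lengths of the longest NE- and SE-chains in
  the rectangle below it, and a column of the shape contains a rook iff the partition changes across
  it at the boundary. Hence conjugating all boundary partitions is an involution that swaps the two
  statistics and keeps the number of rooks.

  The first row obeys the same recursion as the longest NE-chain. For the first column, the rows
  from the second on form the growth diagram of Viennot's skeleton of the placement, whose longest
  SE-chain is shorter by one.
\<close>

section \<open>Partitions\<close>

definition is_partition :: "(nat \<Rightarrow> nat) \<Rightarrow> bool" where
  "is_partition p \<longleftrightarrow> antimono p \<and> (\<exists>n. p n = 0)"

definition conjugate :: "(nat \<Rightarrow> nat) \<Rightarrow> nat \<Rightarrow> nat" where
  "conjugate p j = (LEAST i. p i \<le> j)"

definition add_box :: "nat \<Rightarrow> (nat \<Rightarrow> nat) \<Rightarrow> nat \<Rightarrow> nat" where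
  "add_box r p = p(r := Suc (p r))"

definition box_step :: "(nat \<Rightarrow> nat) \<Rightarrow> (nat \<Rightarrow> nat) \<Rightarrow> bool" where
  "box_step p q \<longleftrightarrow> q = p \<or> (\<exists>r. q = add_box r p)"

lemma is_partitionI:
  assumes "\<And>i. p (Suc i) \<le> p i" and "p n = 0"
  shows "is_partition p"
  unfolding is_partition_def antimono_iff_le_Suc using assms by auto

lemma is_partition_antimono: "is_partition p \<Longrightarrow> i \<le> j \<Longrightarrow> p j \<le> p i"
  by (auto simp: is_partition_def antimono_def)

lemma is_partition_zero [simp]: "is_partition (\<lambda>_. 0)"
  by (simp add: is_partition_def antimono_def)

lemma is_partition_min:
  assumes "is_partition p" and "is_partition q"
  shows "is_partition (\<lambda>i. min (p i) (q i))"
proof -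
  obtain n where "p n = 0" using assms(1) by (auto simp: is_partition_def)
  thus ?thesis
    using is_partition_antimono[OF assms(1)] is_partition_antimono[OF assms(2)]
    by (intro is_partitionI[of _ n]) (auto simp: min_le_iff_disj)
qed

lemma add_box_apply: "add_box r p i = (if i = r then Suc (p i) else p i)"
  by (simp add: add_box_def)

lemma add_box_inject [simp]: "add_box r p = add_box r q \<longleftrightarrow> p = q"
  by (auto simp: add_box_apply fun_eq_iff split: if_splits)

lemma box_step_refl [simp]: "box_step p p"
  by (simp add: box_step_def)

lemma box_step_add_box [simp]: "box_step p (add_box r p)"
  by (auto simp: box_step_def)

lemma box_stepE:
  assumes "box_step p q"
  obtains (refl) "q = p" | (add_box) r where "q = add_box r p"
  using assms by (auto simp: box_step_def)

lemma box_step_le: "box_step p q \<Longrightarrow> p i \<le> q i"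
  by (auto simp: box_step_def add_box_apply)

lemma box_step_le_Suc: "box_step p q \<Longrightarrow> q i \<le> Suc (p i)"
  by (auto simp: box_step_def add_box_apply)

lemma less_conjugate_iff:
  assumes "is_partition p"
  shows "i < conjugate p j \<longleftrightarrow> j < p i"
proof
  show "i < conjugate p j \<Longrightarrow> j < p i"
    unfolding conjugate_def using not_less_Least by fastforce
next
  assume "j < p i"
  obtain n where "p n = 0" using assms by (auto simp: is_partition_def)
  hence "p (conjugate p j) \<le> j"
    unfolding conjugate_def by (simp add: LeastI[where P = "\<lambda>i. p i \<le> j" and k = n])
  thus "i < conjugate p j"
    using \<open>j < p i\<close> is_partition_antimono[OF assms, of "conjugate p j" i] by linarith
qed

lemma eq_if_less_iff_less:
  fixes a b :: "'a :: linorder"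
  assumes "\<And>i. i < a \<longleftrightarrow> i < b"
  shows "a = b"
  by (metis assms less_irrefl linorder_neq_iff)

lemma is_partition_conjugate:
  assumes "is_partition p"
  shows "is_partition (conjugate p)"
proof (rule is_partitionI)
  fix j
  have "\<not> conjugate p j < conjugate p (Suc j)"
    using less_conjugate_iff[OF assms] by (meson Suc_lessD less_irrefl)
  thus "conjugate p (Suc j) \<le> conjugate p j" by simp
next
  have "\<not> i < conjugate p (p 0)" for i
    using is_partition_antimono[OF assms, of 0 i] by (simp add: less_conjugate_iff[OF assms])
  thus "conjugate p (p 0) = 0" by blast
qed

lemma conjugate_conjugate:
  assumes "is_partition p"
  shows "conjugate (conjugate p) = p"
  by (rule ext, rule eq_if_less_iff_less)
    (simp add: less_conjugate_iff assms is_partition_conjugate)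

lemma conjugate_inject:
  "is_partition p \<Longrightarrow> is_partition q \<Longrightarrow> conjugate p = conjugate q \<longleftrightarrow> p = q"
  by (metis conjugate_conjugate)

lemma conjugate_zero: "conjugate (\<lambda>_. 0) = (\<lambda>_. 0)"
  by (simp add: conjugate_def fun_eq_iff)

lemma conjugate_add_box:
  assumes p: "is_partition p" and q: "is_partition (add_box r p)"
  shows "conjugate (add_box r p) = add_box (p r) (conjugate p)"
proof (rule ext, rule eq_if_less_iff_less)
  fix j i
  have above: "p r < p i" if "i < r" for i
    using is_partition_antimono[OF q, of i r] that by (simp add: add_box_apply)
  have below: "p i \<le> p r" if "r \<le> i" for i
    using is_partition_antimono[OF p that] .
  have "conjugate p (p r) = r"
    using above below by - (rule eq_if_less_iff_less, metis less_conjugate_iff[OF p] not_le)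
  thus "i < conjugate (add_box r p) j \<longleftrightarrow> i < add_box (p r) (conjugate p) j"
    using above[of i] below[of i]
    by (cases "j = p r"; cases "i < r")
      (auto simp: less_conjugate_iff[OF p] less_conjugate_iff[OF q] add_box_apply not_less)
qed

lemma box_step_conjugate:
  assumes "is_partition p" and "is_partition q" and "box_step p q"
  shows "box_step (conjugate p) (conjugate q)"
  using assms by (auto elim!: box_stepE simp: conjugate_add_box)

section \<open>The local rule\<close>

text \<open>
  The formula merges the cases of Fomin's rule: if \<open>\<mu> \<noteq> \<nu>\<close> it gives their union, if \<open>\<mu> = \<nu>\<close>
  arises from \<open>\<rho>\<close> by adding a box in row \<open>r\<close> it adds a box in row \<open>r + 1\<close>, and if all three agree
  it adds a box in row \<open>0\<close> exactly when \<open>b\<close> holds.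
\<close>

definition grow :: "bool \<Rightarrow> (nat \<Rightarrow> nat) \<Rightarrow> (nat \<Rightarrow> nat) \<Rightarrow> (nat \<Rightarrow> nat) \<Rightarrow> nat \<Rightarrow> nat" where
  "grow b \<rho> \<mu> \<nu> i =
     max (\<mu> i) (\<nu> i) + (case i of 0 \<Rightarrow> of_bool b | Suc j \<Rightarrow> min (\<mu> j) (\<nu> j) - \<rho> j)"

definition admissible :: "bool \<Rightarrow> (nat \<Rightarrow> nat) \<Rightarrow> (nat \<Rightarrow> nat) \<Rightarrow> (nat \<Rightarrow> nat) \<Rightarrow> bool" where
  "admissible b \<rho> \<mu> \<nu> \<longleftrightarrow> box_step \<rho> \<mu> \<and> box_step \<rho> \<nu> \<and> (b \<longrightarrow> \<mu> = \<rho> \<and> \<nu> = \<rho>)"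

lemma grow_commute: "grow b \<rho> \<mu> \<nu> = grow b \<rho> \<nu> \<mu>"
  by (simp add: grow_def fun_eq_iff max.commute min.commute split: nat.splits)

lemma admissible_commute: "admissible b \<rho> \<mu> \<nu> \<longleftrightarrow> admissible b \<rho> \<nu> \<mu>"
  by (auto simp: admissible_def)

lemma grow_0: "grow b \<rho> \<mu> \<nu> 0 = max (\<mu> 0) (\<nu> 0) + of_bool b"
  by (simp add: grow_def)

lemma grow_ge_left: "\<mu> i \<le> grow b \<rho> \<mu> \<nu> i"
  by (simp add: grow_def)

lemma grow_ge_right: "\<nu> i \<le> grow b \<rho> \<mu> \<nu> i"
  by (simp add: grow_def)

lemma grow_True: "grow True \<rho> \<rho> \<rho> = add_box 0 \<rho>"
  by (auto simp: grow_def fun_eq_iff add_box_apply split: nat.splits)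

lemma grow_absorb: "box_step \<rho> \<nu> \<Longrightarrow> grow False \<rho> \<rho> \<nu> = \<nu>"
  by (auto simp: grow_def fun_eq_iff add_box_apply box_step_def split: nat.splits)

lemma grow_add_box_same:
  "grow False \<rho> (add_box r \<rho>) (add_box r \<rho>) = add_box (Suc r) (add_box r \<rho>)"
  by (auto simp: grow_def fun_eq_iff add_box_apply split: nat.splits)

lemma grow_add_box_distinct:
  "r \<noteq> s \<Longrightarrow> grow False \<rho> (add_box r \<rho>) (add_box s \<rho>) = add_box s (add_box r \<rho>)"
  by (auto simp: grow_def fun_eq_iff add_box_apply split: nat.splits)

lemma box_step_grow:
  assumes "admissible b \<rho> \<mu> \<nu>"
  shows "box_step \<mu> (grow b \<rho> \<mu> \<nu>)"
proof (cases b)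
  case True
  thus ?thesis using assms by (simp add: admissible_def grow_True)
next
  case False
  have "box_step \<rho> \<mu>" and "box_step \<rho> \<nu>" using assms by (auto simp: admissible_def)
  show ?thesis
    using \<open>box_step \<rho> \<mu>\<close>
  proof (cases rule: box_stepE)
    case refl
    thus ?thesis using \<open>box_step \<rho> \<nu>\<close> False by (simp add: grow_absorb)
  next
    case add_\<mu>: (add_box r)
    show ?thesis
      using \<open>box_step \<rho> \<nu>\<close>
    proof (cases rule: box_stepE)
      case refl
      thus ?thesis using \<open>box_step \<rho> \<mu>\<close> False by (simp add: grow_absorb grow_commute[of _ \<rho> \<mu>])
    next
      case (add_box s)
      thus ?thesis
        using add_\<mu> False
        by (cases "r = s") (simp_all add: grow_add_box_same grow_add_box_distinct)
    qed
  qed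
qed

lemma is_partition_grow:
  assumes "box_step \<rho> \<mu>" and "box_step \<rho> \<nu>"
    and part: "is_partition \<rho>" "is_partition \<mu>" "is_partition \<nu>"
  shows "is_partition (grow b \<rho> \<mu> \<nu>)"
proof -
  obtain m n where "\<mu> m = 0" "\<nu> n = 0" using part by (auto simp: is_partition_def)
  hence "grow b \<rho> \<mu> \<nu> (Suc (max m n)) = 0"
    using is_partition_antimono[OF part(2), of m] is_partition_antimono[OF part(3), of n]
    by (simp add: grow_def le_max_iff_disj)
  moreover have "grow b \<rho> \<mu> \<nu> (Suc i) \<le> grow b \<rho> \<mu> \<nu> i" for i
  proof (cases "\<rho> i < \<mu> i \<and> \<rho> i < \<nu> i")
    case True
    hence "\<mu> = add_box i \<rho>" "\<nu> = add_box i \<rho>"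
      using assms(1,2) by (auto simp: box_step_def add_box_apply split: if_splits)
    thus ?thesis
      using is_partition_antimono[OF part(1), of i "Suc i"] by (simp add: grow_def add_box_apply)
  next
    case False
    hence "min (\<mu> i) (\<nu> i) - \<rho> i = 0" by auto
    thus ?thesis
      using is_partition_antimono[OF part(2), of i "Suc i"]
        is_partition_antimono[OF part(3), of i "Suc i"]
      by (auto simp: grow_def)
  qed
  ultimately show ?thesis by (intro is_partitionI)
qed

lemma grow_inject:
  assumes "\<And>i. \<rho> i \<le> \<mu> i" "\<And>i. \<rho> i \<le> \<nu> i" "\<And>i. \<rho>' i \<le> \<mu> i" "\<And>i. \<rho>' i \<le> \<nu> i"
  shows "grow b \<rho> \<mu> \<nu> = grow b' \<rho>' \<mu> \<nu> \<longleftrightarrow> b = b' \<and> \<rho> = \<rho>'"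
proof
  assume eq: "grow b \<rho> \<mu> \<nu> = grow b' \<rho>' \<mu> \<nu>"
  have "b = b'" using fun_cong[OF eq, of 0] by (cases b; cases b') (simp_all add: grow_0)
  moreover have "\<rho> i = \<rho>' i" for i
  proof -
    have "min (\<mu> i) (\<nu> i) - \<rho> i = min (\<mu> i) (\<nu> i) - \<rho>' i"
      using fun_cong[OF eq, of "Suc i"] by (simp add: grow_def)
    thus ?thesis using assms[of i] by (auto simp: min_def split: if_splits)
  qed
  ultimately show "b = b' \<and> \<rho> = \<rho>'" by auto
qed simp

lemma grow_eq_left_iff:
  assumes "\<And>i. \<rho> i \<le> \<mu> i" and "\<And>i. \<rho> i \<le> \<nu> i"
  shows "grow b \<rho> \<mu> \<nu> = \<mu> \<longleftrightarrow> \<nu> = \<rho> \<and> \<not> b"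
proof
  assume eq: "grow b \<rho> \<mu> \<nu> = \<mu>"
  have "\<nu> i = \<rho> i" for i
    using fun_cong[OF eq, of i] fun_cong[OF eq, of "Suc i"] assms[of i]
    by (auto simp: grow_def max_def min_def split: if_splits nat.splits)
  moreover have "\<not> b"
    using fun_cong[OF eq, of 0] by (auto simp: grow_0)
  ultimately show "\<nu> = \<rho> \<and> \<not> b" by auto
next
  assume "\<nu> = \<rho> \<and> \<not> b"
  thus "grow b \<rho> \<mu> \<nu> = \<mu>"
    using assms(1) by (auto simp: grow_def fun_eq_iff max_absorb1 split: nat.splits)
qed

lemma add_box_diamond:
  assumes "add_box r \<mu> = add_box s \<nu>" and "r \<noteq> s"
  shows "\<mu> = add_box s (\<lambda>i. min (\<mu> i) (\<nu> i))"
proof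
  fix i
  have "add_box r \<mu> i = add_box s \<nu> i" using assms(1) by simp
  thus "\<mu> i = add_box s (\<lambda>i. min (\<mu> i) (\<nu> i)) i"
    using assms(2) by (auto simp: add_box_apply split: if_splits)
qed

lemma remove_box:
  assumes "is_partition \<mu>" and "\<mu> (Suc k) < \<mu> k"
  obtains \<rho> where "is_partition \<rho>" and "\<mu> = add_box k \<rho>"
proof
  let ?\<rho> = "\<mu>(k := \<mu> k - 1)"
  obtain n where "\<mu> n = 0" using assms(1) by (auto simp: is_partition_def)
  thus "is_partition ?\<rho>"
    using assms(2) is_partition_antimono[OF assms(1), of i "Suc i" for i]
    by (intro is_partitionI[of _ n]) (auto simp: le_diff_conv le_SucI)
  show "\<mu> = add_box k ?\<rho>" using assms(2) by (auto simp: add_box_apply)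
qed

lemma grow_surj_add_box_same:
  assumes "is_partition (add_box r \<mu>)" and "is_partition \<mu>"
  obtains b \<rho> where "is_partition \<rho>" "admissible b \<rho> \<mu> \<mu>" "add_box r \<mu> = grow b \<rho> \<mu> \<mu>"
proof (cases r)
  case 0
  thus thesis
    using assms(2) by (intro that[of \<mu> True]) (auto simp: admissible_def grow_True)
next
  case (Suc k)
  have "\<mu> (Suc k) < \<mu> k"
    using is_partition_antimono[OF assms(1), of k "Suc k"] Suc by (simp add: add_box_apply)
  then obtain \<rho> where "is_partition \<rho>" "\<mu> = add_box k \<rho>" using remove_box assms(2) by blast
  thus thesis
    using Suc by (intro that[of \<rho> False]) (auto simp: admissible_def grow_add_box_same)
qed

lemma grow_surj:
  assumes part: "is_partition \<kappa>" "is_partition \<mu>" "is_partition \<nu>"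
    and "box_step \<mu> \<kappa>" and "box_step \<nu> \<kappa>"
  obtains b \<rho> where "is_partition \<rho>" "admissible b \<rho> \<mu> \<nu>" "\<kappa> = grow b \<rho> \<mu> \<nu>"
proof -
  consider "\<kappa> = \<mu>" | "\<kappa> = \<nu>" | r s where "\<kappa> = add_box r \<mu>" "\<kappa> = add_box s \<nu>"
    using assms(4,5) unfolding box_step_def by blast
  thus thesis
  proof cases
    case 1
    thus thesis
      using assms by (intro that[of \<nu> False])
        (auto simp: admissible_def grow_absorb grow_commute[of _ \<nu> \<mu>])
  next
    case 2
    thus thesis using assms by (intro that[of \<mu> False]) (auto simp: admissible_def grow_absorb)
  next
    case (3 r s)
    show thesis
    proof (cases "r = s")
      case True
      hence "\<nu> = \<mu>" using 3 by simp
      thus thesis using grow_surj_add_box_same[of r \<mu>] that part(1,2) 3(1) by blast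
    next
      case False
      define \<rho> where "\<rho> = (\<lambda>i. min (\<mu> i) (\<nu> i))"
      have "is_partition \<rho>" unfolding \<rho>_def using part(2,3) by (rule is_partition_min)
      moreover have "\<mu> = add_box s \<rho>" "\<nu> = add_box r \<rho>"
        using add_box_diamond[of r \<mu> s \<nu>] add_box_diamond[of s \<nu> r \<mu>] 3 False
        by (simp_all add: \<rho>_def min.commute)
      moreover from this have "\<kappa> = grow False \<rho> \<mu> \<nu>"
        using 3(1) False by (simp add: grow_add_box_distinct)
      ultimately show thesis by (intro that[of \<rho> False]) (simp_all add: admissible_def)
    qed
  qed
qed

section \<open>Growth diagrams\<close>

definition rook_placement :: "cell set \<Rightarrow> bool" where
  "rook_placement A \<longleftrightarrow> single_valued A \<and> single_valued (A\<inverse>)"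

definition rect :: "cell \<Rightarrow> cell set" where
  "rect p = {0<..fst p} \<times> {0<..snd p}"

fun growth :: "cell set \<Rightarrow> cell \<Rightarrow> nat \<Rightarrow> nat" where
  "growth A (0, y) = (\<lambda>_. 0)"
| "growth A (Suc x, 0) = (\<lambda>_. 0)"
| "growth A (Suc x, Suc y) =
     grow ((Suc x, Suc y) \<in> A) (growth A (x, y)) (growth A (x, Suc y)) (growth A (Suc x, y))"

lemma rook_placement_converse [simp]: "rook_placement (A\<inverse>) \<longleftrightarrow> rook_placement A"
  by (auto simp: rook_placement_def)

lemma rook_placement_column: "rook_placement A \<Longrightarrow> (x, y) \<in> A \<Longrightarrow> (x, y') \<in> A \<Longrightarrow> y = y'"
  by (auto simp: rook_placement_def dest: single_valuedD)

lemma rook_placement_row: "rook_placement A \<Longrightarrow> (x, y) \<in> A \<Longrightarrow> (x', y) \<in> A \<Longrightarrow> x = x'"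
  by (auto simp: rook_placement_def dest: single_valuedD)

lemma mem_rect_iff [simp]:
  "c \<in> rect p \<longleftrightarrow> 0 < fst c \<and> fst c \<le> fst p \<and> 0 < snd c \<and> snd c \<le> snd p"
  by (auto simp: rect_def mem_Times_iff)

lemma rect_mono: "fst p \<le> fst q \<Longrightarrow> snd p \<le> snd q \<Longrightarrow> rect p \<subseteq> rect q"
  by (auto simp: rect_def)

lemma growth_0_right [simp]: "growth A (x, 0) = (\<lambda>_. 0)"
  by (cases x) auto

lemma growth_converse: "growth (A\<inverse>) (x, y) = growth A (y, x)"
proof (induction A "(x, y)" arbitrary: x y rule: growth.induct)
  case (3 A x y)
  thus ?case by (simp add: grow_commute[of _ "growth A (y, x)" "growth A (Suc y, x)"])
qed simp_all

lemma growth_cong: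
  assumes "A \<inter> rect p = B \<inter> rect p"
  shows "growth A p = growth B p"
  using assms
proof (induction A p rule: growth.induct)
  case (3 A x y)
  have smaller: "A \<inter> rect q = B \<inter> rect q" if "q \<in> {(x, y), (x, Suc y), (Suc x, y)}" for q
  proof -
    have "rect q \<subseteq> rect (Suc x, Suc y)" using that by (intro rect_mono) auto
    thus ?thesis using "3.prems" by blast
  qed
  have "(Suc x, Suc y) \<in> rect (Suc x, Suc y)" by simp
  hence "(Suc x, Suc y) \<in> A \<longleftrightarrow> (Suc x, Suc y) \<in> B" using "3.prems" by blast
  thus ?case using "3.IH" smaller by simp
qed simp_all

lemma growth_mono_Suc_left: "growth A (x, y) i \<le> growth A (Suc x, y) i"
  by (cases y) (simp_all add: grow_ge_left)

lemma growth_mono_Suc_right: "growth A (x, y) i \<le> growth A (x, Suc y) i"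
  by (cases x) (simp_all add: grow_ge_right)

lemma growth_mono:
  assumes "x \<le> x'" and "y \<le> y'"
  shows "growth A (x, y) i \<le> growth A (x', y') i"
proof -
  have "growth A (x, y) i \<le> growth A (x', y) i"
    using growth_mono_Suc_left assms(1) by (rule lift_Suc_mono_le)
  also have "\<dots> \<le> growth A (x', y') i"
    using growth_mono_Suc_right assms(2) by (rule lift_Suc_mono_le)
  finally show ?thesis .
qed

lemma growth_column_eq_iff:
  "growth A (Suc x, y) = growth A (x, y) \<longleftrightarrow> (\<forall>j. 0 < j \<and> j \<le> y \<longrightarrow> (Suc x, j) \<notin> A)"
proof (induction y)
  case (Suc y)
  have "growth A (Suc x, Suc y) = growth A (x, Suc y) \<longleftrightarrow>
      growth A (Suc x, y) = growth A (x, y) \<and> (Suc x, Suc y) \<notin> A"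
    unfolding growth.simps by (intro grow_eq_left_iff growth_mono_Suc_left growth_mono_Suc_right)
  thus ?case using Suc by (auto simp: le_Suc_eq)
qed simp

lemma growth_row_eq_iff:
  "growth A (x, Suc y) = growth A (x, y) \<longleftrightarrow> (\<forall>i. 0 < i \<and> i \<le> x \<longrightarrow> (i, Suc y) \<notin> A)"
  using growth_column_eq_iff[of "A\<inverse>" y x] by (simp add: growth_converse)

lemma growth_at_rook:
  assumes "rook_placement A" and "(Suc x, Suc y) \<in> A"
  shows "growth A (Suc x, y) = growth A (x, y)" and "growth A (x, Suc y) = growth A (x, y)"
  using rook_placement_column[OF assms] rook_placement_row[OF assms]
  unfolding growth_column_eq_iff growth_row_eq_iff by (metis Suc_n_not_le_n)+

lemma box_step_growth:
  assumes "rook_placement A"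
  shows "box_step (growth A (x, y)) (growth A (Suc x, y))"
    and "box_step (growth A (x, y)) (growth A (x, Suc y))"
proof -
  have "box_step (growth A (x - 1, y)) (growth A (x, y)) \<and>
      box_step (growth A (x, y - 1)) (growth A (x, y))" for x y
    using assms
  proof (induction A "(x, y)" arbitrary: x y rule: growth.induct)
    case (3 A x y)
    let ?b = "(Suc x, Suc y) \<in> A"
    have "box_step (growth A (x, y)) (growth A (x, Suc y))"
      and "box_step (growth A (x, y)) (growth A (Suc x, y))"
      using 3 by simp_all
    hence "admissible ?b (growth A (x, y)) (growth A (x, Suc y)) (growth A (Suc x, y))"
      using growth_at_rook[OF "3.prems"] by (simp add: admissible_def)
    thus ?case
      using box_step_grow admissible_commute grow_commute by (metis diff_Suc_1 growth.simps(3))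
  qed simp_all
  from this[of "Suc x" y] this[of x "Suc y"]
  show "box_step (growth A (x, y)) (growth A (Suc x, y))"
    and "box_step (growth A (x, y)) (growth A (x, Suc y))" by simp_all
qed

lemma is_partition_growth:
  assumes "rook_placement A"
  shows "is_partition (growth A p)"
  using assms
proof (induction A p rule: growth.induct)
  case (3 A x y)
  thus ?case using box_step_growth[OF "3.prems"] by (simp add: is_partition_grow)
qed simp_all

section \<open>Chains in rectangles\<close>

lemma distinct_if_successively:
  assumes "transp R" "irreflp R" "successively R cs"
  shows "distinct cs"
proof -
  have "sorted_wrt R cs" using assms(1,3) by (simp add: successively_conv_sorted_wrt)
  thus ?thesis using assms(2) by (induction cs) (auto dest: irreflpD)
qed

lemma successively_last:
  assumes "transp R" "successively R cs" "c \<in> set cs"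
  shows "c = last cs \<or> R c (last cs)"
  using assms
  by (cases cs rule: rev_cases) (auto simp: successively_conv_sorted_wrt sorted_wrt_append)

lemma successively_hd:
  assumes "transp R" "successively R cs" "c \<in> set cs"
  shows "c = hd cs \<or> R (hd cs) c"
  using assms by (cases cs) (auto simp: successively_conv_sorted_wrt)

definition has_chain :: "('a \<Rightarrow> 'a \<Rightarrow> bool) \<Rightarrow> 'a set \<Rightarrow> nat \<Rightarrow> bool" where
  "has_chain R S k \<longleftrightarrow> (\<exists>cs. length cs = k \<and> set cs \<subseteq> S \<and> successively R cs)"

lemma has_chain_mono: "has_chain R S k \<Longrightarrow> S \<subseteq> T \<Longrightarrow> has_chain R T k"
  unfolding has_chain_def by blast

lemma has_chain_0 [simp]: "has_chain R S 0"
  by (simp add: has_chain_def)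

lemma has_chain_antimono:
  assumes "has_chain R S k" and "j \<le> k"
  shows "has_chain R S j"
proof -
  obtain cs where cs: "length cs = k" "set cs \<subseteq> S" "successively R cs"
    using assms(1) by (auto simp: has_chain_def)
  have "successively R (take j cs @ drop j cs)" using cs(3) by simp
  hence "successively R (take j cs)" by (simp only: successively_append_iff)
  moreover have "set (take j cs) \<subseteq> S" using cs(2) set_take_subset by fast
  ultimately show ?thesis
    using cs(1) assms(2) by (auto simp: has_chain_def intro!: exI[of _ "take j cs"])
qed

lemma has_chain_SucE:
  assumes "has_chain R S (Suc k)"
  obtains c cs where "length cs = k" "successively R (c # cs)" "set (c # cs) \<subseteq> S"
proof -
  obtain ds where ds: "length ds = Suc k" "set ds \<subseteq> S" "successively R ds"
    using assms by (auto simp: has_chain_def)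
  then obtain c cs where "ds = c # cs" by (cases ds) auto
  thus thesis using that ds by simp
qed

lemma has_chain_1_iff: "has_chain R S (Suc 0) \<longleftrightarrow> S \<noteq> {}"
proof
  assume "S \<noteq> {}"
  then obtain c where "c \<in> S" by blast
  thus "has_chain R S (Suc 0)" by (auto simp: has_chain_def intro!: exI[of _ "[c]"])
qed (auto elim: has_chain_SucE)

abbreviation NE :: "cell \<Rightarrow> cell \<Rightarrow> bool" where
  "NE c d \<equiv> fst c < fst d \<and> snd c < snd d"

abbreviation SE :: "cell \<Rightarrow> cell \<Rightarrow> bool" where
  "SE c d \<equiv> fst c < fst d \<and> snd c > snd d"

lemma transp_NE: "transp NE" and irreflp_NE: "irreflp NE"
  by (auto simp: transp_def irreflp_def)

lemma transp_SE: "transp SE" and irreflp_SE: "irreflp SE"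
  by (auto simp: transp_def irreflp_def)

lemma growth_first_row:
  "growth A (Suc x, Suc y) 0 =
     max (growth A (x, Suc y) 0) (growth A (Suc x, y) 0) + of_bool ((Suc x, Suc y) \<in> A)"
  by (simp add: grow_0)

lemma NE_chain_length_le_growth:
  assumes "successively NE (cs @ [c])" and "set (cs @ [c]) \<subseteq> A \<inter> rect p"
  shows "Suc (length cs) \<le> growth A c 0"
  using assms
proof (induction cs arbitrary: c rule: rev_induct)
  case Nil
  then obtain i j where "c = (Suc i, Suc j)" "c \<in> A"
    by (cases c) (auto simp: gr0_conv_Suc)
  thus ?case using growth_first_row[of A i j] by simp
next
  case (snoc d cs)
  then obtain i j where c: "c = (Suc i, Suc j)" "c \<in> A"
    by (cases c) (auto simp: gr0_conv_Suc)
  obtain i' j' where d: "d = (i', j')" by (cases d)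
  have "successively NE (cs @ [d])" and "i' \<le> i" "j' \<le> j"
    using snoc.prems(1) c d by (auto simp: successively_append_iff)
  hence "Suc (length cs) \<le> growth A d 0"
    using snoc.prems by (intro snoc.IH) auto
  also have "\<dots> \<le> growth A (i, Suc j) 0"
    using \<open>i' \<le> i\<close> \<open>j' \<le> j\<close> unfolding d by (intro growth_mono) auto
  finally show ?case using growth_first_row[of A i j] c by simp
qed

lemma has_NE_chain_growth:
  assumes "rook_placement A"
  shows "has_chain NE (A \<inter> rect p) (growth A p 0)"
  using assms
proof (induction A p rule: growth.induct)
  case (3 A x y)
  let ?p = "(Suc x, Suc y)"
  show ?case
  proof (cases "?p \<in> A")
    case True
    have "growth A ?p 0 = Suc (growth A (x, y) 0)"
      using growth_at_rook[OF "3.prems" True] True by (simp add: grow_0)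
    moreover obtain cs where cs: "length cs = growth A (x, y) 0" "set cs \<subseteq> A \<inter> rect (x, y)"
      "successively NE cs"
      using 3 by (auto simp: has_chain_def)
    have "successively NE (cs @ [?p])"
      using cs(2,3) last_in_set[of cs] by (fastforce simp: successively_append_iff)
    moreover have "set (cs @ [?p]) \<subseteq> A \<inter> rect ?p"
      using cs(2) True by auto
    ultimately show ?thesis
      unfolding has_chain_def using cs(1) by (intro exI[of _ "cs @ [?p]"]) simp
  next
    case False
    hence "growth A ?p 0 \<in> {growth A (x, Suc y) 0, growth A (Suc x, y) 0}"
      by (simp add: grow_0 max_def)
    moreover have "has_chain NE (A \<inter> rect ?p) (growth A (x, Suc y) 0)"
      using 3 rect_mono[of "(x, Suc y)" ?p] by (intro has_chain_mono[OF "3.IH"(2)]) auto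
    moreover have "has_chain NE (A \<inter> rect ?p) (growth A (Suc x, y) 0)"
      using 3 rect_mono[of "(Suc x, y)" ?p] by (intro has_chain_mono[OF "3.IH"(3)]) auto
    ultimately show ?thesis by auto
  qed
qed simp_all

theorem has_NE_chain_iff:
  assumes "rook_placement A"
  shows "has_chain NE (A \<inter> rect p) k \<longleftrightarrow> k \<le> growth A p 0"
proof
  assume "has_chain NE (A \<inter> rect p) k"
  then obtain cs where cs: "length cs = k" "set cs \<subseteq> A \<inter> rect p" "successively NE cs"
    by (auto simp: has_chain_def)
  show "k \<le> growth A p 0"
  proof (cases cs rule: rev_cases)
    case (snoc ds c)
    hence "k \<le> growth A c 0"
      using NE_chain_length_le_growth[of ds c A p] cs by simp
    also have "\<dots> \<le> growth A p 0"
      using cs(2) snoc growth_mono by (cases c; cases p) auto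
    finally show ?thesis .
  qed (use cs in simp)
qed (use has_NE_chain_growth[OF assms] has_chain_antimono in blast)

section \<open>Viennot's skeleton\<close>

text \<open>
  Every rook emits a ray upwards and a ray to the right; two rays meeting in a cell from below and
  from the left annihilate each other there. The first row of the growth diagram counts rays, so
  \<open>up_ray A x y\<close> says that an upward ray crosses the edge from \<open>(x, y)\<close> to \<open>(x + 1, y)\<close>, and the
  skeleton consists of the cells of annihilation.
\<close>

definition up_ray :: "cell set \<Rightarrow> nat \<Rightarrow> nat \<Rightarrow> bool" where
  "up_ray A x y \<longleftrightarrow> growth A (x, y) 0 < growth A (Suc x, y) 0"

definition skeleton :: "cell set \<Rightarrow> cell set" where
  "skeleton A = {(Suc x, Suc y) | x y.
     growth A (x, y) 0 < min (growth A (x, Suc y) 0) (growth A (Suc x, y) 0)}"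

lemma Suc_mem_skeleton_iff:
  "(Suc x, Suc y) \<in> skeleton A \<longleftrightarrow> up_ray A x y \<and> up_ray (A\<inverse>) y x"
  by (auto simp: skeleton_def up_ray_def growth_converse)

lemma skeleton_converse: "skeleton (A\<inverse>) = (skeleton A)\<inverse>"
  by (auto simp: skeleton_def growth_converse)

lemma grow_tail:
  assumes "min (\<mu> 0) (\<nu> 0) \<le> Suc (\<rho> 0)"
  shows "(\<lambda>i. grow b \<rho> \<mu> \<nu> (Suc i)) =
    grow (\<rho> 0 < min (\<mu> 0) (\<nu> 0)) (\<lambda>i. \<rho> (Suc i)) (\<lambda>i. \<mu> (Suc i)) (\<lambda>i. \<nu> (Suc i))"
  using assms by (auto simp: grow_def fun_eq_iff split: nat.splits)

lemma growth_tail: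
  assumes "rook_placement A"
  shows "(\<lambda>i. growth A p (Suc i)) = growth (skeleton A) p"
  using assms
proof (induction A p rule: growth.induct)
  case (3 A x y)
  have "growth A (x, Suc y) 0 \<le> Suc (growth A (x, y) 0)"
    using box_step_growth(2)[OF "3.prems"] by (rule box_step_le_Suc)
  hence "(\<lambda>i. growth A (Suc x, Suc y) (Suc i)) =
      grow ((Suc x, Suc y) \<in> skeleton A) (\<lambda>i. growth A (x, y) (Suc i))
        (\<lambda>i. growth A (x, Suc y) (Suc i)) (\<lambda>i. growth A (Suc x, y) (Suc i))"
    unfolding growth.simps by (subst grow_tail) (auto simp: skeleton_def simp del: growth.simps)
  thus ?case using 3 by simp
qed simp_all

lemma up_ray_Suc:
  assumes "rook_placement A"
  shows "up_ray A x (Suc y) \<longleftrightarrow>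
    (Suc x, Suc y) \<in> A \<or> up_ray A x y \<and> (Suc x, Suc y) \<notin> skeleton A"
proof (cases "(Suc x, Suc y) \<in> A")
  case True
  thus ?thesis
    using growth_at_rook[OF assms True] by (simp add: up_ray_def grow_0)
next
  case False
  have "growth A (x, y) 0 \<le> growth A (x, Suc y) 0"
    and "growth A (x, Suc y) 0 \<le> Suc (growth A (x, y) 0)"
    and "growth A (x, y) 0 \<le> growth A (Suc x, y) 0"
    and "growth A (Suc x, y) 0 \<le> Suc (growth A (x, y) 0)"
    using box_step_growth[OF assms] box_step_le box_step_le_Suc by blast+
  thus ?thesis
    using False by (auto simp: skeleton_def up_ray_def grow_0)
qed

lemma up_ray_iff:
  assumes "rook_placement A"
  shows "up_ray A x y \<longleftrightarrow>
    (\<exists>j. 0 < j \<and> j \<le> y \<and> (Suc x, j) \<in> A \<and> (\<forall>k. j < k \<and> k \<le> y \<longrightarrow> (Suc x, k) \<notin> skeleton A))"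
proof (induction y)
  case 0
  show ?case by (simp add: up_ray_def)
next
  case (Suc y)
  show ?case
    unfolding up_ray_Suc[OF assms] Suc by (auto simp: le_Suc_eq)
qed

lemma mem_skeleton_iff:
  assumes "rook_placement A"
  shows "(x, y) \<in> skeleton A \<longleftrightarrow>
    (\<exists>j. 0 < j \<and> j < y \<and> (x, j) \<in> A \<and> (\<forall>k. j < k \<and> k < y \<longrightarrow> (x, k) \<notin> skeleton A)) \<and>
    (\<exists>i. 0 < i \<and> i < x \<and> (i, y) \<in> A \<and> (\<forall>k. i < k \<and> k < x \<longrightarrow> (k, y) \<notin> skeleton A))"
proof (cases "0 < x \<and> 0 < y")
  case True
  then obtain a b where "x = Suc a" "y = Suc b" by (auto simp: gr0_conv_Suc)
  thus ?thesis
    using up_ray_iff[OF assms] up_ray_iff[of "A\<inverse>"] assms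
    by (simp add: Suc_mem_skeleton_iff less_Suc_eq_le skeleton_converse)
next
  case False
  thus ?thesis by (auto simp: skeleton_def)
qed

lemma single_valued_skeleton:
  assumes "rook_placement A"
  shows "single_valued (skeleton A)"
proof -
  have "\<not> y < y'" if cells: "(x, y) \<in> skeleton A" "(x, y') \<in> skeleton A" for x y y'
  proof
    assume "y < y'"
    obtain j where "j < y" "(x, j) \<in> A"
      using cells(1) mem_skeleton_iff[OF assms] by blast
    moreover obtain j' where "(x, j') \<in> A" "\<forall>k. j' < k \<and> k < y' \<longrightarrow> (x, k) \<notin> skeleton A"
      using cells(2) mem_skeleton_iff[OF assms, of x y'] by blast
    ultimately show False
      using rook_placement_column[OF assms] \<open>y < y'\<close> cells(1) by blast
  qed
  thus ?thesis by (meson single_valuedI linorder_neqE_nat)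
qed

lemma rook_placement_skeleton:
  assumes "rook_placement A"
  shows "rook_placement (skeleton A)"
  using single_valued_skeleton[OF assms] single_valued_skeleton[of "A\<inverse>"] assms
  by (simp add: rook_placement_def skeleton_converse)

lemma skeleton_between_rooks:
  assumes "rook_placement A" "c \<in> A" "d \<in> A" "SE c d" "0 < fst c" "0 < snd d"
  shows "\<exists>b \<in> skeleton A. fst c < fst b \<and> fst b \<le> fst d \<and> snd d < snd b \<and> snd b \<le> snd c"
proof (cases "(fst d, snd c) \<in> skeleton A")
  case True
  thus ?thesis using assms(4) by (intro bexI[of _ "(fst d, snd c)"]) auto
next
  case False
  have "(fst c, snd c) \<in> A" and "(fst d, snd d) \<in> A" using assms(2,3) by simp_all
  then consider j where "snd d < j" "j < snd c" "(fst d, j) \<in> skeleton A"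
    | i where "fst c < i" "i < fst d" "(i, snd c) \<in> skeleton A"
    using False assms(4-) unfolding mem_skeleton_iff[OF assms(1), of "fst d" "snd c"] by blast
  thus ?thesis
    using assms(4) by cases (auto intro: less_imp_le bexI[rotated])
qed

lemma rook_between_skeleton:
  assumes "rook_placement A" "c \<in> skeleton A" "d \<in> skeleton A" "SE c d"
  shows "\<exists>b \<in> A. fst c \<le> fst b \<and> fst b < fst d \<and> snd d \<le> snd b \<and> snd b < snd c"
proof -
  obtain j where j: "0 < j" "j < snd c" "(fst c, j) \<in> A"
    "\<forall>k. j < k \<and> k < snd c \<longrightarrow> (fst c, k) \<notin> skeleton A"
    using assms(2) mem_skeleton_iff[OF assms(1), of "fst c" "snd c"] by auto
  obtain i where i: "0 < i" "i < fst d" "(i, snd d) \<in> A"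
    "\<forall>k. i < k \<and> k < fst d \<longrightarrow> (k, snd d) \<notin> skeleton A"
    using assms(3) mem_skeleton_iff[OF assms(1), of "fst d" "snd d"] by auto
  have "snd d \<le> j \<or> fst c \<le> i"
  proof (rule ccontr)
    assume "\<not> (snd d \<le> j \<or> fst c \<le> i)"
    hence "j < snd d" "i < fst c" by auto
    hence "(fst c, snd d) \<in> skeleton A"
      using i j assms(4) unfolding mem_skeleton_iff[OF assms(1), of "fst c" "snd d"]
      by (meson less_trans)
    thus False using j(4) \<open>j < snd d\<close> assms(4) by blast
  qed
  thus ?thesis
  proof
    assume "snd d \<le> j"
    thus ?thesis using j(2,3) assms(4) by (intro bexI[of _ "(fst c, j)"]) auto
  next
    assume "fst c \<le> i"
    thus ?thesis using i(2,3) assms(4) by (intro bexI[of _ "(i, snd d)"]) auto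
  qed
qed

lemma SE_chain_skeleton:
  assumes "rook_placement A" "successively SE (c # cs)" "set (c # cs) \<subseteq> A \<inter> rect p"
  shows "\<exists>bs. length bs = length cs \<and> successively SE bs \<and> set bs \<subseteq> skeleton A \<inter> rect p \<and>
    (bs \<noteq> [] \<longrightarrow> fst c < fst (hd bs) \<and> snd (hd bs) \<le> snd c)"
  using assms(2,3)
proof (induction cs arbitrary: c)
  case Nil
  show ?case by simp
next
  case (Cons d cs)
  obtain b where "b \<in> skeleton A" "fst c < fst b" "fst b \<le> fst d" "snd d < snd b" "snd b \<le> snd c"
    using skeleton_between_rooks[OF assms(1), of c d] Cons.prems by auto
  moreover obtain bs where "length bs = length cs" "successively SE bs"
    "set bs \<subseteq> skeleton A \<inter> rect p" "bs \<noteq> [] \<longrightarrow> fst d < fst (hd bs) \<and> snd (hd bs) \<le> snd d"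
    using Cons.IH[of d] Cons.prems by auto
  ultimately show ?case
    using Cons.prems
    by (intro exI[of _ "b # bs"]) (auto simp: successively_Cons)
qed

lemma SE_chain_of_skeleton:
  assumes "rook_placement A" "successively SE (b # bs)" "set (b # bs) \<subseteq> skeleton A \<inter> rect p"
  shows "\<exists>cs. length cs = Suc (length bs) \<and> successively SE cs \<and> set cs \<subseteq> A \<inter> rect p \<and>
    fst b \<le> fst (hd cs) \<and> snd (hd cs) < snd b"
  using assms(2,3)
proof (induction bs arbitrary: b)
  case Nil
  then obtain j where "0 < j" "j < snd b" "(fst b, j) \<in> A"
    using mem_skeleton_iff[OF assms(1), of "fst b" "snd b"] by auto
  thus ?case using Nil by (intro exI[of _ "[(fst b, j)]"]) auto
next
  case (Cons d bs)
  obtain c where "c \<in> A" "fst b \<le> fst c" "fst c < fst d" "snd d \<le> snd c" "snd c < snd b"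
    using rook_between_skeleton[OF assms(1), of b d] Cons.prems by auto
  moreover obtain cs where "length cs = Suc (length bs)" "successively SE cs"
    "set cs \<subseteq> A \<inter> rect p" "fst d \<le> fst (hd cs)" "snd (hd cs) < snd d"
    using Cons.IH[of d] Cons.prems by auto
  ultimately show ?case
    using Cons.prems
    by (intro exI[of _ "c # cs"]) (auto simp: successively_Cons)
qed

lemma has_SE_chain_skeleton_iff:
  assumes "rook_placement A"
  shows "has_chain SE (skeleton A \<inter> rect p) (Suc k) \<longleftrightarrow> has_chain SE (A \<inter> rect p) (Suc (Suc k))"
proof
  assume "has_chain SE (A \<inter> rect p) (Suc (Suc k))"
  then obtain c cs where cs: "length cs = Suc k" "successively SE (c # cs)"
    "set (c # cs) \<subseteq> A \<inter> rect p"
    by (rule has_chain_SucE)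
  obtain bs where "length bs = Suc k" "successively SE bs" "set bs \<subseteq> skeleton A \<inter> rect p"
    using SE_chain_skeleton[OF assms cs(2,3)] cs(1) by auto
  thus "has_chain SE (skeleton A \<inter> rect p) (Suc k)"
    unfolding has_chain_def by (intro exI[of _ bs]) simp
next
  assume "has_chain SE (skeleton A \<inter> rect p) (Suc k)"
  then obtain b bs where bs: "length bs = k" "successively SE (b # bs)"
    "set (b # bs) \<subseteq> skeleton A \<inter> rect p"
    by (rule has_chain_SucE)
  obtain cs where cs: "length cs = Suc k" "successively SE cs" "set cs \<subseteq> A \<inter> rect p"
    "fst b \<le> fst (hd cs)" "snd (hd cs) < snd b"
    using SE_chain_of_skeleton[OF assms bs(2,3)] bs(1) by blast
  obtain i where "0 < i" "i < fst b" "(i, snd b) \<in> A"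
    using mem_skeleton_iff[OF assms, of "fst b" "snd b"] bs(3) by auto
  hence "successively SE ((i, snd b) # cs)" "set ((i, snd b) # cs) \<subseteq> A \<inter> rect p"
    using cs bs(3) by (auto simp: successively_Cons)
  thus "has_chain SE (A \<inter> rect p) (Suc (Suc k))"
    using cs(1) unfolding has_chain_def by (intro exI[of _ "(i, snd b) # cs"]) simp
qed

theorem has_SE_chain_iff:
  assumes "rook_placement A"
  shows "has_chain SE (A \<inter> rect p) (Suc k) \<longleftrightarrow> 0 < growth A p k"
  using assms
proof (induction k arbitrary: A)
  case 0
  show ?case
    using has_NE_chain_iff[OF 0, of p "Suc 0"] by (simp add: has_chain_1_iff Suc_le_eq)
next
  case (Suc k)
  have "0 < growth A p (Suc k) \<longleftrightarrow> 0 < growth (skeleton A) p k"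
    using fun_cong[OF growth_tail[OF Suc.prems]] by simp
  thus ?case
    using Suc.IH[OF rook_placement_skeleton[OF Suc.prems]]
    by (simp add: has_SE_chain_skeleton_iff[OF Suc.prems])
qed

section \<open>Growth along the boundary\<close>

definition young_diagram :: "cell set \<Rightarrow> bool" where
  "young_diagram F \<longleftrightarrow> finite F \<and> (\<forall>p \<in> F. 0 < fst p \<and> 0 < snd p \<and> rect p \<subseteq> F)"

definition corner :: "cell set \<Rightarrow> cell \<Rightarrow> bool" where
  "corner F c \<longleftrightarrow> c \<in> F \<and> (\<forall>d \<in> F. fst c \<le> fst d \<longrightarrow> snd c \<le> snd d \<longrightarrow> d = c)"

text \<open>
  A lattice point \<open>(x, y)\<close> is the north-east vertex of the cell \<open>(x, y)\<close>, so the axes belong to the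
  closure of every diagram.
\<close>

definition boundary :: "cell set \<Rightarrow> cell set" where
  "boundary F = {(x, y). (x = 0 \<or> y = 0 \<or> (x, y) \<in> F) \<and> (Suc x, Suc y) \<notin> F}"

definition boundary_labelling :: "cell set \<Rightarrow> (cell \<Rightarrow> nat \<Rightarrow> nat) \<Rightarrow> bool" where
  "boundary_labelling F L \<longleftrightarrow> (\<forall>x y. (x, y) \<in> boundary F \<longrightarrow>
     is_partition (L (x, y)) \<and>
     (x = 0 \<or> y = 0 \<longrightarrow> L (x, y) = (\<lambda>_. 0)) \<and>
     ((Suc x, y) \<in> boundary F \<longrightarrow> box_step (L (x, y)) (L (Suc x, y))) \<and>
     ((x, Suc y) \<in> boundary F \<longrightarrow> box_step (L (x, y)) (L (x, Suc y))))"

definition placements :: "cell set \<Rightarrow> cell set set" where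
  "placements F = {A. A \<subseteq> F \<and> rook_placement A}"

lemma young_diagram_finite: "young_diagram F \<Longrightarrow> finite F"
  by (simp add: young_diagram_def)

lemma young_diagram_pos: "young_diagram F \<Longrightarrow> (x, y) \<in> F \<Longrightarrow> 0 < x \<and> 0 < y"
  by (auto simp: young_diagram_def)

lemma young_diagram_down:
  assumes "young_diagram F" "(x, y) \<in> F" "0 < x'" "x' \<le> x" "0 < y'" "y' \<le> y"
  shows "(x', y') \<in> F"
proof -
  have "rect (x, y) \<subseteq> F" using assms(1,2) by (auto simp: young_diagram_def)
  thus ?thesis using assms(3-) by auto
qed

lemma corner_exists:
  assumes "young_diagram F" "F \<noteq> {}"
  obtains a b where "corner F (Suc a, Suc b)"
proof -
  let ?S = "(\<lambda>c. fst c + snd c) ` F"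
  have "finite ?S" using assms(1) by (simp add: young_diagram_finite)
  hence "Max ?S \<in> ?S" using assms(2) by (intro Max_in) auto
  then obtain c where "c \<in> F" "Max ?S = fst c + snd c" by auto
  hence c: "c \<in> F" "\<And>d. d \<in> F \<Longrightarrow> fst d + snd d \<le> fst c + snd c"
    using Max_ge[OF \<open>finite ?S\<close>] by fastforce+
  moreover obtain a b where "c = (Suc a, Suc b)"
    using young_diagram_pos[OF assms(1), of "fst c" "snd c"] c(1)
    by (cases c) (auto simp: gr0_conv_Suc)
  ultimately show thesis by (intro that[of a b]) (fastforce simp: corner_def)
qed

lemma corner_maximal:
  assumes "corner F (Suc a, Suc b)" "(x, y) \<in> F" "(x, y) \<noteq> (Suc a, Suc b)"
  shows "x \<le> a \<or> y \<le> b"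
  using assms by (fastforce simp: corner_def)

lemma young_diagram_remove_corner:
  assumes "young_diagram F" "corner F c"
  shows "young_diagram (F - {c})"
proof -
  have "rect p \<subseteq> F - {c}" if "p \<in> F" "p \<noteq> c" for p
    using assms that by (auto simp: young_diagram_def corner_def)
  thus ?thesis using assms(1) by (auto simp: young_diagram_def)
qed

lemma young_diagram_induct [consumes 1, case_names empty corner]:
  assumes "young_diagram F"
    and "P {}"
    and "\<And>F a b. \<lbrakk>young_diagram F; corner F (Suc a, Suc b); P (F - {(Suc a, Suc b)})\<rbrakk> \<Longrightarrow> P F"
  shows "P F"
  using assms(1)
proof (induction "card F" arbitrary: F rule: less_induct)
  case less
  show ?case
  proof (cases "F = {}")
    case False
    then obtain a b where corner: "corner F (Suc a, Suc b)" using corner_exists less.prems by blast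
    hence "card (F - {(Suc a, Suc b)}) < card F"
      using less.prems by (intro card_Diff1_less) (auto simp: corner_def young_diagram_finite)
    thus ?thesis
      using less corner assms(3) young_diagram_remove_corner by blast
  qed (use assms(2) in simp)
qed

lemma boundary_remove_corner:
  assumes "young_diagram F" "corner F (Suc a, Suc b)"
  shows "boundary (F - {(Suc a, Suc b)}) = insert (a, b) (boundary F - {(Suc a, Suc b)})"
proof -
  have "a = 0 \<or> b = 0 \<or> (a, b) \<in> F"
    using young_diagram_down[OF assms(1), of "Suc a" "Suc b" a b] assms(2)
    by (auto simp: corner_def)
  thus ?thesis
    using assms(2) by (fastforce simp: boundary_def corner_def)
qed

lemma corner_boundary:
  assumes "young_diagram F" "corner F (Suc a, Suc b)"
  shows "(Suc a, Suc b) \<in> boundary F" "(a, Suc b) \<in> boundary F" "(Suc a, b) \<in> boundary F"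
    "(a, b) \<notin> boundary F"
proof -
  have mem: "x = 0 \<or> y = 0 \<or> (x, y) \<in> F" if "x \<le> Suc a" "y \<le> Suc b" for x y
    using young_diagram_down[OF assms(1), of "Suc a" "Suc b" x y] assms(2) that
    by (auto simp: corner_def)
  have beyond: "(Suc x, Suc y) \<notin> F" if "a \<le> x" "b \<le> y" "(x, y) \<noteq> (a, b)" for x y
    using corner_maximal[OF assms(2), of "Suc x" "Suc y"] that by auto
  show "(Suc a, Suc b) \<in> boundary F" "(a, Suc b) \<in> boundary F" "(Suc a, b) \<in> boundary F"
    "(a, b) \<notin> boundary F"
    using mem[of "Suc a" "Suc b"] mem[of a "Suc b"] mem[of "Suc a" b] beyond
    by (auto simp: boundary_def)
qed

lemma boundary_not_beyond_corner:
  assumes "corner F (Suc a, Suc b)" "p \<in> boundary F" "p \<noteq> (Suc a, Suc b)"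
  shows "fst p \<le> a \<or> snd p \<le> b"
  using assms corner_maximal[OF assms(1), of "fst p" "snd p"] by (auto simp: boundary_def)

lemma column_top:
  assumes "young_diagram F" "(x, j) \<in> F"
  obtains y where "j \<le> y" "(x, y) \<in> F" "(x, Suc y) \<notin> F"
proof -
  let ?Y = "Pair x -` F"
  have fin: "finite ?Y"
    using young_diagram_finite[OF assms(1)] by (intro finite_vimageI) (auto simp: inj_def)
  have "Max ?Y \<in> ?Y" using assms(2) fin by (intro Max_in) auto
  moreover have "Suc (Max ?Y) \<notin> ?Y" using Max_ge[OF fin] by fastforce
  moreover have "j \<le> Max ?Y" using assms(2) fin by simp
  ultimately show thesis by (intro that[of "Max ?Y"]) auto
qed

lemma boundary_nonempty:
  assumes "young_diagram F"
  shows "boundary F \<noteq> {}"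
proof (cases "F = {}")
  case True
  hence "(0, 0) \<in> boundary F" by (simp add: boundary_def)
  thus ?thesis by blast
next
  case False
  thus ?thesis using corner_exists[OF assms] corner_boundary(1)[OF assms] by blast
qed

lemma ex_boundary_rect:
  assumes "young_diagram F" "c \<in> F"
  obtains p where "p \<in> boundary F" "rect c \<subseteq> rect p"
proof -
  obtain y where y: "snd c \<le> y" "(fst c, y) \<in> F" "(fst c, Suc y) \<notin> F"
    using column_top[OF assms(1), of "fst c" "snd c"] assms(2) by auto
  have "(Suc (fst c), Suc y) \<notin> F"
    using y young_diagram_down[OF assms(1), of "Suc (fst c)" "Suc y" "fst c" "Suc y"]
      young_diagram_pos[OF assms(1) y(2)] by auto
  hence "(fst c, y) \<in> boundary F" using y by (simp add: boundary_def)
  thus thesis using that y(1) rect_mono[of c "(fst c, y)"] by simp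
qed

theorem growth_boundary_inject:
  assumes "young_diagram F" "A \<subseteq> F" "B \<subseteq> F"
    and "\<And>p. p \<in> boundary F \<Longrightarrow> growth A p = growth B p"
  shows "A = B"
  using assms
proof (induction F arbitrary: A B rule: young_diagram_induct)
  case empty
  thus ?case by simp
next
  case (corner F a b)
  let ?c = "(Suc a, Suc b)"
  note at_corner = corner_boundary(1-3)[OF corner.hyps, THEN corner.prems(3)]
  have grow_eq: "grow (?c \<in> A) (growth A (a, b)) (growth A (a, Suc b)) (growth A (Suc a, b)) =
      grow (?c \<in> B) (growth B (a, b)) (growth A (a, Suc b)) (growth A (Suc a, b))"
    using at_corner by simp
  have "growth B (a, b) i \<le> growth A (a, Suc b) i" "growth B (a, b) i \<le> growth A (Suc a, b) i" for i
    unfolding at_corner by (rule growth_mono_Suc_right growth_mono_Suc_left)+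
  hence mem_eq: "?c \<in> A \<longleftrightarrow> ?c \<in> B" and inner_eq: "growth A (a, b) = growth B (a, b)"
    using iffD1[OF grow_inject grow_eq] growth_mono_Suc_left growth_mono_Suc_right by auto
  have "A - {?c} = B - {?c}"
  proof (rule corner.IH)
    fix p assume "p \<in> boundary (F - {?c})"
    hence p: "p = (a, b) \<or> p \<in> boundary F \<and> p \<noteq> ?c"
      unfolding boundary_remove_corner[OF corner.hyps] by blast
    hence "fst p \<le> a \<or> snd p \<le> b"
      using boundary_not_beyond_corner[OF corner.hyps(2), of p] by auto
    hence "growth (D - {?c}) p = growth D p" for D by (intro growth_cong) auto
    thus "growth (A - {?c}) p = growth (B - {?c}) p"
      using p inner_eq corner.prems(3)[of p] by auto
  qed (use corner.prems in auto)
  thus ?case using mem_eq by blast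
qed

lemma boundary_labelling_growth: "rook_placement A \<Longrightarrow> boundary_labelling F (growth A)"
  by (auto simp: boundary_labelling_def is_partition_growth box_step_growth)

lemma boundary_labelling_conjugate:
  assumes "boundary_labelling F L"
  shows "boundary_labelling F (\<lambda>p. conjugate (L p))"
  using assms unfolding boundary_labelling_def
  by (simp add: box_step_conjugate is_partition_conjugate conjugate_zero)

lemma boundary_labelling_remove_corner:
  assumes F: "young_diagram F" "corner F (Suc a, Suc b)" and L: "boundary_labelling F L"
    and \<rho>: "is_partition \<rho>" "box_step \<rho> (L (a, Suc b))" "box_step \<rho> (L (Suc a, b))"
  shows "boundary_labelling (F - {(Suc a, Suc b)}) (L((a, b) := \<rho>))"
    (is "boundary_labelling ?F ?L")
proof -
  note at_corner = corner_boundary[OF F]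
  have mem_boundary: "p \<in> boundary ?F \<longleftrightarrow> p = (a, b) \<or> p \<in> boundary F \<and> p \<noteq> (Suc a, Suc b)" for p
    unfolding boundary_remove_corner[OF F] by blast
  have isolated: "(x, y) \<notin> boundary ?F" if "(a, b) \<in> {(Suc x, y), (x, Suc y)}" for x y
    using young_diagram_down[OF F(1), of "Suc a" "Suc b"] F(2) that
    by (auto simp: boundary_def corner_def)
  have zero: "\<rho> = (\<lambda>_. 0)" if "a = 0 \<or> b = 0"
  proof -
    have "L (a, Suc b) = (\<lambda>_. 0) \<or> L (Suc a, b) = (\<lambda>_. 0)"
      using L at_corner that unfolding boundary_labelling_def by blast
    thus ?thesis using box_step_le[OF \<rho>(2)] box_step_le[OF \<rho>(3)] by (auto simp: fun_eq_iff)
  qed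
  note L = L[unfolded boundary_labelling_def, rule_format]
  show ?thesis
    unfolding boundary_labelling_def
  proof (intro allI impI conjI)
    fix x y assume xy: "(x, y) \<in> boundary ?F"
    show "is_partition (?L (x, y))" using xy \<rho>(1) L[of x y] by (auto simp: mem_boundary)
    show "?L (x, y) = (\<lambda>_. 0)" if "x = 0 \<or> y = 0"
      using xy that zero L[of x y] by (auto simp: mem_boundary)
    show "box_step (?L (x, y)) (?L (Suc x, y))" if "(Suc x, y) \<in> boundary ?F"
      using xy that isolated[of x y] \<rho>(3) L[of x y] by (auto simp: mem_boundary)
    show "box_step (?L (x, y)) (?L (x, Suc y))" if "(x, Suc y) \<in> boundary ?F"
      using xy that isolated[of x y] \<rho>(2) L[of x y] by (auto simp: mem_boundary)
  qed
qed

lemma insert_corner_placement: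
  assumes F: "young_diagram F" "corner F (Suc a, Suc b)"
    and B: "B \<in> placements (F - {(Suc a, Suc b)})"
    and "growth B (Suc a, b) = growth B (a, b)" and "growth B (a, Suc b) = growth B (a, b)"
  shows "insert (Suc a, Suc b) B \<in> placements F"
proof -
  have mem: "0 < x" "0 < y" "x \<le> a \<or> y \<le> b" if "(x, y) \<in> B" for x y
  proof -
    have xy: "(x, y) \<in> F" "(x, y) \<noteq> (Suc a, Suc b)" using that B by (auto simp: placements_def)
    show "0 < x" "0 < y" using young_diagram_pos[OF F(1) xy(1)] by simp_all
    show "x \<le> a \<or> y \<le> b" using corner_maximal[OF F(2) xy] .
  qed
  have "(Suc a, y) \<notin> B" for y
    using mem[of "Suc a" y] assms(4) unfolding growth_column_eq_iff by fastforce
  moreover have "(x, Suc b) \<notin> B" for x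
    using mem[of x "Suc b"] assms(5) unfolding growth_row_eq_iff by fastforce
  ultimately show ?thesis
    using B F(2)
    by (auto simp: placements_def rook_placement_def single_valued_def corner_def)
qed

lemma extend_placement_at_corner:
  assumes F: "young_diagram F" "corner F (Suc a, Suc b)"
    and B: "B \<in> placements (F - {(Suc a, Suc b)})"
    and adm: "admissible z (growth B (a, b)) (growth B (a, Suc b)) (growth B (Suc a, b))"
  obtains A where "A \<in> placements F"
    and "growth A (Suc a, Suc b) =
      grow z (growth B (a, b)) (growth B (a, Suc b)) (growth B (Suc a, b))"
    and "\<And>p. fst p \<le> a \<or> snd p \<le> b \<Longrightarrow> growth A p = growth B p"
proof
  let ?c = "(Suc a, Suc b)"
  let ?A = "if z then insert ?c B else B"
  show "?A \<in> placements F"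
    using insert_corner_placement[OF F B] B adm by (auto simp: admissible_def placements_def)
  show outside: "growth ?A p = growth B p" if "fst p \<le> a \<or> snd p \<le> b" for p
    using that by (intro growth_cong) auto
  have "?c \<in> ?A \<longleftrightarrow> z" using B by (auto simp: placements_def)
  thus "growth ?A ?c = grow z (growth B (a, b)) (growth B (a, Suc b)) (growth B (Suc a, b))"
    by (simp only: growth.simps(3) outside fst_conv snd_conv order_refl simp_thms)
qed

theorem growth_boundary_surj:
  assumes "young_diagram F" "boundary_labelling F L"
  shows "\<exists>A \<in> placements F. \<forall>p \<in> boundary F. growth A p = L p"
  using assms
proof (induction F arbitrary: L rule: young_diagram_induct)
  case empty
  hence "growth {} p = L p" if "p \<in> boundary {}" for p
    using that by (auto simp: boundary_labelling_def boundary_def)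
  thus ?case by (intro bexI[of _ "{}"]) (auto simp: placements_def rook_placement_def)
next
  case (corner F a b)
  let ?c = "(Suc a, Suc b)"
  note at_corner = corner_boundary[OF corner.hyps]
  have "is_partition (L ?c)" "is_partition (L (a, Suc b))" "is_partition (L (Suc a, b))"
    "box_step (L (a, Suc b)) (L ?c)" "box_step (L (Suc a, b)) (L ?c)"
    using corner.prems at_corner unfolding boundary_labelling_def by blast+
  then obtain z \<rho> where \<rho>: "is_partition \<rho>" "admissible z \<rho> (L (a, Suc b)) (L (Suc a, b))"
    and L_corner: "L ?c = grow z \<rho> (L (a, Suc b)) (L (Suc a, b))"
    by (rule grow_surj)
  hence "boundary_labelling (F - {?c}) (L((a, b) := \<rho>))"
    using boundary_labelling_remove_corner[OF corner.hyps corner.prems]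
    by (simp add: admissible_def)
  then obtain B where B: "B \<in> placements (F - {?c})"
    and "\<And>p. p \<in> boundary (F - {?c}) \<Longrightarrow> growth B p = (L((a, b) := \<rho>)) p"
    using corner.IH by blast
  hence inner: "growth B (a, b) = \<rho>"
    and outer: "\<And>p. p \<in> boundary F \<Longrightarrow> p \<noteq> ?c \<Longrightarrow> growth B p = L p"
    using at_corner(4) by (auto simp: boundary_remove_corner[OF corner.hyps])
  obtain A where A: "A \<in> placements F" "growth A ?c = L ?c"
    and A_outside: "\<And>p. fst p \<le> a \<or> snd p \<le> b \<Longrightarrow> growth A p = growth B p"
    using extend_placement_at_corner[OF corner.hyps B, of z] \<rho>(2) at_corner(2,3)
    by (auto simp: inner outer L_corner)
  moreover have "growth A p = L p" if "p \<in> boundary F" "p \<noteq> ?c" for p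
    using boundary_not_beyond_corner[OF corner.hyps(2) that] A_outside outer[OF that] by simp
  ultimately show ?case by blast
qed

section \<open>Conjugation of placements\<close>

definition conjugate_placement :: "cell set \<Rightarrow> cell set \<Rightarrow> cell set" where
  "conjugate_placement F A =
     (THE B. B \<in> placements F \<and> (\<forall>p \<in> boundary F. growth B p = conjugate (growth A p)))"

lemma
  assumes "young_diagram F" "A \<in> placements F"
  shows conjugate_placement_mem: "conjugate_placement F A \<in> placements F"
    and growth_conjugate_placement:
      "p \<in> boundary F \<Longrightarrow> growth (conjugate_placement F A) p = conjugate (growth A p)"
proof -
  have "rook_placement A" using assms(2) by (simp add: placements_def)
  then obtain B where B: "B \<in> placements F" "\<forall>p \<in> boundary F. growth B p = conjugate (growth A p)"
    using growth_boundary_surj[OF assms(1)] boundary_labelling_growth boundary_labelling_conjugate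
    by meson
  have "conjugate_placement F A = B"
    unfolding conjugate_placement_def
  proof (rule the_equality)
    show "B' = B" if "B' \<in> placements F \<and> (\<forall>p \<in> boundary F. growth B' p = conjugate (growth A p))"
      for B'
      using growth_boundary_inject[OF assms(1), of B' B] B that by (simp add: placements_def)
  qed (use B in simp)
  thus "conjugate_placement F A \<in> placements F"
    and "p \<in> boundary F \<Longrightarrow> growth (conjugate_placement F A) p = conjugate (growth A p)"
    using B by auto
qed

lemma conjugate_placement_involution:
  assumes F: "young_diagram F" and A: "A \<in> placements F"
  shows "conjugate_placement F (conjugate_placement F A) = A"
proof (rule growth_boundary_inject[OF F])
  have conj: "conjugate_placement F A \<in> placements F" using F A by (rule conjugate_placement_mem)
  show "conjugate_placement F (conjugate_placement F A) \<subseteq> F" and "A \<subseteq> F"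
    using conjugate_placement_mem[OF F conj] A by (auto simp: placements_def)
  fix p assume "p \<in> boundary F"
  thus "growth (conjugate_placement F (conjugate_placement F A)) p = growth A p"
    using A growth_conjugate_placement[OF F conj] growth_conjugate_placement[OF F A]
    by (simp add: placements_def conjugate_conjugate is_partition_growth)
qed

lemma Suc_mem_Domain_iff:
  assumes F: "young_diagram F" and "A \<subseteq> F"
  shows "Suc x \<in> Domain A \<longleftrightarrow> (\<exists>y. (x, y) \<in> boundary F \<and> (Suc x, y) \<in> boundary F \<and>
    growth A (Suc x, y) \<noteq> growth A (x, y))"
proof
  assume "Suc x \<in> Domain A"
  then obtain j where j: "(Suc x, j) \<in> A" "(Suc x, j) \<in> F" using assms(2) by blast
  then obtain y where y: "j \<le> y" "(Suc x, y) \<in> F" "(Suc x, Suc y) \<notin> F"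
    using column_top[OF F] by blast
  have "0 < j" using young_diagram_pos[OF F j(2)] by simp
  have "(x, y) \<in> boundary F" and "(Suc x, y) \<in> boundary F"
    using y young_diagram_down[OF F y(2), of x y] young_diagram_pos[OF F y(2)]
      young_diagram_down[OF F, of "Suc (Suc x)" "Suc y" "Suc x" "Suc y"]
    by (auto simp: boundary_def)
  moreover have "growth A (Suc x, y) \<noteq> growth A (x, y)"
    unfolding growth_column_eq_iff using j(1) y(1) \<open>0 < j\<close> by blast
  ultimately show "\<exists>y. (x, y) \<in> boundary F \<and> (Suc x, y) \<in> boundary F \<and>
    growth A (Suc x, y) \<noteq> growth A (x, y)" by blast
qed (auto simp: growth_column_eq_iff)

lemma Domain_conjugate_placement:
  assumes F: "young_diagram F" and A: "A \<in> placements F"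
  shows "Domain (conjugate_placement F A) = Domain A"
proof -
  have sub: "A \<subseteq> F" "conjugate_placement F A \<subseteq> F" and "rook_placement A"
    using A conjugate_placement_mem[OF F A] by (simp_all add: placements_def)
  have neq_iff: "growth (conjugate_placement F A) p \<noteq> growth (conjugate_placement F A) q \<longleftrightarrow>
      growth A p \<noteq> growth A q" if "p \<in> boundary F" "q \<in> boundary F" for p q
    using that \<open>rook_placement A\<close>
    by (simp add: growth_conjugate_placement[OF F A] conjugate_inject is_partition_growth)
  have "x \<in> Domain (conjugate_placement F A) \<longleftrightarrow> x \<in> Domain A" for x
  proof (cases x)
    case 0
    thus ?thesis using sub young_diagram_pos[OF F] by blast
  next
    case (Suc x')
    show ?thesis
      unfolding Suc Suc_mem_Domain_iff[OF F sub(1)] Suc_mem_Domain_iff[OF F sub(2)]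
      by (intro ex_cong1 conj_cong refl neq_iff)
  qed
  thus ?thesis by blast
qed

lemma card_eq_card_Domain:
  assumes "single_valued A"
  shows "card A = card (Domain A)"
proof -
  have "inj_on fst A" using assms by (auto simp: inj_on_def dest: single_valuedD)
  thus ?thesis by (simp add: Domain_fst card_image)
qed

lemma card_conjugate_placement:
  assumes "young_diagram F" "A \<in> placements F"
  shows "card (conjugate_placement F A) = card A"
proof -
  have "single_valued A" "single_valued (conjugate_placement F A)"
    using assms conjugate_placement_mem[OF assms] by (auto simp: placements_def rook_placement_def)
  thus ?thesis by (simp add: card_eq_card_Domain Domain_conjugate_placement[OF assms])
qed

section \<open>Longest chains\<close>

definition longest_chain :: "(cell \<Rightarrow> cell \<Rightarrow> bool) \<Rightarrow> cell set \<Rightarrow> cell set \<Rightarrow> nat" where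
  "longest_chain R F A =
     Max {length cs | cs. successively R cs \<and> (\<exists>p \<in> boundary F. set cs \<subseteq> A \<inter> rect p)}"

lemma less_longest_chain_iff:
  assumes F: "young_diagram F" and "finite A" and R: "transp R" "irreflp R"
  shows "k < longest_chain R F A \<longleftrightarrow> (\<exists>p \<in> boundary F. has_chain R (A \<inter> rect p) (Suc k))"
proof -
  let ?L = "{length cs | cs. successively R cs \<and> (\<exists>p \<in> boundary F. set cs \<subseteq> A \<inter> rect p)}"
  have "length cs \<le> card A" if "successively R cs" "set cs \<subseteq> A" for cs
    using card_mono[OF assms(2) that(2)] distinct_card[OF distinct_if_successively[OF R that(1)]]
    by simp
  hence "?L \<subseteq> {..card A}" by auto
  hence "finite ?L" by (rule finite_subset) simp
  moreover have "?L \<noteq> {}"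
    using boundary_nonempty[OF F] by (auto intro!: exI[of _ "[]"])
  ultimately have "k < longest_chain R F A \<longleftrightarrow> (\<exists>l \<in> ?L. k < l)"
    unfolding longest_chain_def by (rule Max_gr_iff)
  also have "\<dots> \<longleftrightarrow> (\<exists>p \<in> boundary F. \<exists>l. has_chain R (A \<inter> rect p) l \<and> Suc k \<le> l)"
    by (auto simp: has_chain_def Suc_le_eq)
  also have "\<dots> \<longleftrightarrow> (\<exists>p \<in> boundary F. has_chain R (A \<inter> rect p) (Suc k))"
    using has_chain_antimono by blast
  finally show ?thesis .
qed

lemma placement_finite: "young_diagram F \<Longrightarrow> A \<in> placements F \<Longrightarrow> finite A"
  using young_diagram_finite finite_subset by (auto simp: placements_def)

lemma less_longest_NE_chain_iff:
  assumes "young_diagram F" "A \<in> placements F"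
  shows "k < longest_chain NE F A \<longleftrightarrow> (\<exists>p \<in> boundary F. k < growth A p 0)"
  using assms has_NE_chain_iff[of A]
  by (simp add: less_longest_chain_iff transp_NE irreflp_NE placement_finite placements_def
      Suc_le_eq)

lemma less_longest_SE_chain_iff:
  assumes "young_diagram F" "A \<in> placements F"
  shows "k < longest_chain SE F A \<longleftrightarrow> (\<exists>p \<in> boundary F. k < conjugate (growth A p) 0)"
  using assms has_SE_chain_iff[of A]
  by (simp add: less_longest_chain_iff transp_SE irreflp_SE placement_finite placements_def
      less_conjugate_iff is_partition_growth)

lemma longest_NE_chain_conjugate_placement:
  assumes "young_diagram F" "A \<in> placements F"
  shows "longest_chain NE F (conjugate_placement F A) = longest_chain SE F A"
  using assms
  by - (rule eq_if_less_iff_less, simp add: less_longest_NE_chain_iff less_longest_SE_chain_iff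
      conjugate_placement_mem growth_conjugate_placement)

lemma longest_SE_chain_conjugate_placement:
  assumes "young_diagram F" "A \<in> placements F"
  shows "longest_chain SE F (conjugate_placement F A) = longest_chain NE F A"
  using longest_NE_chain_conjugate_placement[OF assms(1) conjugate_placement_mem[OF assms]]
  by (simp add: conjugate_placement_involution[OF assms])

section \<open>Fillings\<close>

lemma bij_betw_ones: "bij_betw (ones F) (fillings F) (Pow F)"
proof (rule bij_betw_byWitness[where f' = "\<lambda>A. \<lambda>c\<in>F. of_bool (c \<in> A)"])
  show "\<forall>f \<in> fillings F. (\<lambda>c\<in>F. of_bool (c \<in> ones F f)) = f"
  proof (intro ballI ext)
    fix f c assume f: "f \<in> fillings F"
    have "c \<in> F \<Longrightarrow> f c \<in> {0, 1}" and "c \<notin> F \<Longrightarrow> f c = undefined"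
      using f unfolding fillings_def by (blast intro: PiE_mem PiE_arb)+
    thus "(\<lambda>c\<in>F. of_bool (c \<in> ones F f)) c = f c"
      by (cases "c \<in> F") (auto simp: ones_def)
  qed
qed (auto simp: fillings_def ones_def)

lemma at_most_one_per_line_iff:
  assumes "finite F"
  shows "at_most_one_per_line F f \<longleftrightarrow> rook_placement (ones F f)"
proof -
  have fin: "finite {c \<in> ones F f. P c}" for P
    using assms by (auto simp: ones_def)
  show ?thesis
    unfolding at_most_one_per_line_def rook_placement_def single_valued_def One_nat_def
      card_le_Suc0_iff_eq[OF fin] by fastforce
qed

lemma NE_chain_iff:
  assumes F: "young_diagram F"
  shows "NE_chain F f cs \<longleftrightarrow>
    successively NE cs \<and> (\<exists>p \<in> boundary F. set cs \<subseteq> ones F f \<inter> rect p)"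
proof
  assume "NE_chain F f cs"
  hence cs: "set cs \<subseteq> ones F f" "successively NE cs" by (auto simp: NE_chain_def)
  show "successively NE cs \<and> (\<exists>p \<in> boundary F. set cs \<subseteq> ones F f \<inter> rect p)"
  proof (cases "cs = []")
    case True
    thus ?thesis using boundary_nonempty[OF F] by auto
  next
    case False
    have "ones F f \<subseteq> F" by (auto simp: ones_def)
    hence "last cs \<in> F" using False cs(1) last_in_set by blast
    then obtain p where p: "p \<in> boundary F" "rect (last cs) \<subseteq> rect p"
      by (rule ex_boundary_rect[OF F])
    have "c \<in> rect (last cs)" if "c \<in> set cs" for c
      using successively_last[OF transp_NE cs(2) that] young_diagram_pos[OF F, of "fst c" "snd c"]
        that cs(1) \<open>ones F f \<subseteq> F\<close> by auto
    thus ?thesis using p cs by blast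
  qed
qed (auto simp: NE_chain_def)

lemma SE_chain_iff:
  assumes F: "young_diagram F"
  shows "SE_chain F f cs \<and> enclosing_rectangle cs \<subseteq> F \<longleftrightarrow>
    successively SE cs \<and> (\<exists>p \<in> boundary F. set cs \<subseteq> ones F f \<inter> rect p)"
proof
  assume "SE_chain F f cs \<and> enclosing_rectangle cs \<subseteq> F"
  hence cs: "set cs \<subseteq> ones F f" "successively SE cs" and enc: "enclosing_rectangle cs \<subseteq> F"
    by (auto simp: SE_chain_def)
  show "successively SE cs \<and> (\<exists>p \<in> boundary F. set cs \<subseteq> ones F f \<inter> rect p)"
  proof (cases "cs = []")
    case True
    thus ?thesis using boundary_nonempty[OF F] by auto
  next
    case False
    let ?c = "(fst (last cs), snd (hd cs))"
    have "?c \<in> enclosing_rectangle cs" using False by (simp add: enclosing_rectangle_def)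
    then obtain p where p: "p \<in> boundary F" "rect ?c \<subseteq> rect p"
      using ex_boundary_rect[OF F] enc by blast
    have "ones F f \<subseteq> F" by (auto simp: ones_def)
    have "c \<in> rect ?c" if "c \<in> set cs" for c
      using successively_last[OF transp_SE cs(2) that] successively_hd[OF transp_SE cs(2) that]
        young_diagram_pos[OF F, of "fst c" "snd c"] that cs(1) \<open>ones F f \<subseteq> F\<close> by auto
    thus ?thesis using p cs by blast
  qed
next
  assume "successively SE cs \<and> (\<exists>p \<in> boundary F. set cs \<subseteq> ones F f \<inter> rect p)"
  then obtain p where cs: "successively SE cs" "set cs \<subseteq> ones F f" "set cs \<subseteq> rect p"
    and p: "p \<in> boundary F" by auto
  have "c \<in> rect p" if "cs \<noteq> []" "c \<in> enclosing_rectangle cs" for c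
  proof -
    have "hd cs \<in> rect p" "last cs \<in> rect p"
      using that(1) cs(3) by (meson hd_in_set last_in_set subsetD)+
    thus ?thesis using that by (auto simp: enclosing_rectangle_def)
  qed
  hence "enclosing_rectangle cs \<subseteq> rect p" by (cases "cs = []") (auto simp: enclosing_rectangle_def)
  also have "\<dots> \<subseteq> F" using F p by (auto simp: boundary_def young_diagram_def)
  finally show "SE_chain F f cs \<and> enclosing_rectangle cs \<subseteq> F"
    using cs by (simp add: SE_chain_def)
qed

lemma num_fillings_eq_card_placements:
  assumes F: "young_diagram F"
  shows "num_fillings F n s t =
    card {A \<in> placements F. card A = n \<and> longest_chain NE F A = s \<and> longest_chain SE F A = t}"
proof -
  have "longest_NE F f = longest_chain NE F (ones F f)"
    and "longest_SE F f = longest_chain SE F (ones F f)" for f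
    by (simp_all add: longest_NE_def longest_SE_def longest_chain_def NE_chain_iff[OF F]
        SE_chain_iff[OF F])
  hence "bij_betw (ones F)
      {f \<in> fillings F. card (ones F f) = n \<and> at_most_one_per_line F f \<and>
        longest_NE F f = s \<and> longest_SE F f = t}
      {A \<in> Pow F. card A = n \<and> rook_placement A \<and>
        longest_chain NE F A = s \<and> longest_chain SE F A = t}"
    using F by (intro bij_betw_Collect bij_betw_ones)
      (simp add: at_most_one_per_line_iff young_diagram_finite)
  hence "num_fillings F n s t = card {A \<in> Pow F. card A = n \<and> rook_placement A \<and>
      longest_chain NE F A = s \<and> longest_chain SE F A = t}"
    unfolding num_fillings_def by (rule bij_betw_same_card)
  also have "\<dots> = card {A \<in> placements F. card A = n \<and>
      longest_chain NE F A = s \<and> longest_chain SE F A = t}"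
    by (rule arg_cong[of _ _ card]) (auto simp: placements_def)
  finally show ?thesis .
qed

lemma young_diagram_ferrers_cells:
  assumes "sorted_wrt (\<ge>) hs"
  shows "young_diagram (ferrers_cells hs)"
proof -
  let ?F = "ferrers_cells hs"
  have mono: "hs ! j \<le> hs ! i" if "i \<le> j" "j < length hs" for i j
    using sorted_wrt_nth_less[OF assms, of i j] that by (cases "i = j") auto
  have "?F \<subseteq> {..length hs} \<times> {..Max (set hs)}"
    by (auto simp: ferrers_cells_def intro!: order_trans[OF _ Max_ge])
  hence "finite ?F" by (rule finite_subset) simp
  moreover have "rect p \<subseteq> ?F" if "p \<in> ?F" for p
  proof
    fix q assume "q \<in> rect p"
    moreover from this have "hs ! (fst p - 1) \<le> hs ! (fst q - 1)"
      using that by (intro mono) (auto simp: ferrers_cells_def)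
    ultimately show "q \<in> ?F" using that by (auto simp: ferrers_cells_def)
  qed
  moreover have "0 < fst p \<and> 0 < snd p" if "p \<in> ?F" for p
    using that by (auto simp: ferrers_cells_def)
  ultimately show ?thesis by (simp add: young_diagram_def)
qed

theorem theorem3:
  fixes F :: "cell set" and n s t :: nat
  assumes "ferrers_shape F" and "s > 0" and "t > 0"
  shows "num_fillings F n s t = num_fillings F n t s"
proof -
  have F: "young_diagram F"
    using assms(1) young_diagram_ferrers_cells by (auto simp: ferrers_shape_def)
  define P where "P s t = {A \<in> placements F. card A = n \<and>
    longest_chain NE F A = s \<and> longest_chain SE F A = t}" for s t
  have "conjugate_placement F A \<in> P t s" if "A \<in> P s t" for A s t
    using that F by (simp add: P_def conjugate_placement_mem card_conjugate_placement
        longest_NE_chain_conjugate_placement longest_SE_chain_conjugate_placement)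
  moreover have "conjugate_placement F (conjugate_placement F A) = A" if "A \<in> P s t" for A s t
    using that F by (simp add: P_def conjugate_placement_involution)
  ultimately have "bij_betw (conjugate_placement F) (P s t) (P t s)"
    by (intro bij_betw_byWitness[where f' = "conjugate_placement F"]) auto
  thus ?thesis
    by (simp add: num_fillings_eq_card_placements[OF F] P_def bij_betw_same_card)
qed

end
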